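(* Let $r\in\mathbb N$, let $w_1,\dots,w_r$ be positive real numbers, and let $q\in\mathbb C$ with $0<|q|<1$. For every $x\in\mathbb C$ with $\Re(x)>0$ and every integer $n\ge 0$, $$\zeta_q^{(r)}(-n,x\mid w_1,\dots,w_r)=E_{n,q}^{(r)}(x\mid w_1,\dots,w_r).$$
   Context: Fix a branch of $\log q$ and put $q^{a}=\exp(a\log q)$ for real $a$. The Barnes' type $q$-Euler polynomials of order $r$, $E_{n,q}^{(r)}(x\mid w_1,\dots,w_r)$, are defined by the Taylor expansion around $t=0$ $$\frac{2^r}{\prod_{j=1}^r\left(e^{w_jt}q^{w_j}+1\right)}\,e^{xt}=\sum_{n=0}^{\infty}E_{n,q}^{(r)}(x\mid w_1,\dots,w_r)\frac{t^n}{n!}.$$ For $s,x\in\mathbb C$ with $\Re(x)>0$, the Barnes' type $q$-zeta function of order $r$ is $$\zeta_q^{(r)}(s,x\mid w_1,\dots,w_r)=2^r\sum_{m_1,\dots,m_r=0}^{\infty}\frac{(-1)^{m_1+\cdots+m_r}\,q^{m_1w_1+\cdots+m_rw_r}}{(x+w_1m_1+\cdots+w_rm_r)^s},$$ where the sum is over all $r$-tuples of nonnegative integers and complex powers $z^s$ with $\Re(z)>0$ are taken with the principal branch of the logarithm. *)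

theory Defs
  imports "HOL-Complex_Analysis.Complex_Analysis"
begin

(* A branch of log q is a complex number L with exp L = q; it is the first argument of
   everything below, and determines q.  The parameters w_1, ..., w_r are the values of
   w :: nat => real on {1..r}. *)

definition qpow :: "complex \<Rightarrow> real \<Rightarrow> complex" where
  "qpow L a = exp (of_real a * L)"

definition q_euler_gf ::
    "complex \<Rightarrow> nat \<Rightarrow> (nat \<Rightarrow> real) \<Rightarrow> complex \<Rightarrow> complex \<Rightarrow> complex" where
  "q_euler_gf L r w x t =
     2 ^ r / (\<Prod>j=1..r. exp (of_real (w j) * t) * qpow L (w j) + 1) * exp (x * t)"

(* The factor fact n appears because the expansion is in powers t^n / n!. *)
definition q_euler ::
    "complex \<Rightarrow> nat \<Rightarrow> (nat \<Rightarrow> real) \<Rightarrow> nat \<Rightarrow> complex \<Rightarrow> complex" where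
  "q_euler L r w n x = fact n * fps_nth (fps_expansion (q_euler_gf L r w x) 0) n"

(* The r-tuples of nonnegative integers are the extensional functions on {1..r}.
   On complex numbers, powr uses the principal branch Ln.  The definition is
   intended for Re x > 0 and positive w_j, so that no base is 0. *)
definition q_zeta ::
    "complex \<Rightarrow> nat \<Rightarrow> (nat \<Rightarrow> real) \<Rightarrow> complex \<Rightarrow> complex \<Rightarrow> complex" where
  "q_zeta L r w s x =
     2 ^ r * (\<Sum>\<^sub>\<infinity>m \<in> {1..r} \<rightarrow>\<^sub>E (UNIV :: nat set).
       (-1) ^ (\<Sum>j=1..r. m j) * qpow L (\<Sum>j=1..r. real (m j) * w j)
         / (x + (\<Sum>j=1..r. of_real (w j) * of_nat (m j))) powr s)"

end

theory Submission
  imports Defs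
begin

text \<open>
  For \<open>Re t < - Re L\<close> every factor \<open>1 / (e\<^bsup>wt\<^esup> q\<^bsup>w\<^esup> + 1)\<close> is a geometric series, so the
  generating function is a constant multiple of an absolutely convergent sum of terms
  \<open>c\<^sub>m exp (a\<^sub>m t)\<close> with \<open>a\<^sub>m = x + \<Sum> w\<^sub>j m\<^sub>j\<close>. Expanding each exponential and
  interchanging the two summations shows that \<open>n!\<close> times the \<open>n\<close>-th Taylor coefficient is
  the sum of the \<open>c\<^sub>m a\<^sub>m\<^sup>n\<close>, which is the zeta series at \<open>-n\<close>.
\<close>

text \<open>Summing \<open>norm (c i * (a i * t) ^ n / fact n)\<close> over \<open>n\<close> gives
  \<open>norm (c i) * exp (norm (a i * t))\<close>. So the summability hypothesis is absolute
  convergence of the double series over \<open>i\<close> and \<open>n\<close> when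
  \<open>norm t = \<rho>\<close>, and it permits the interchange of the two sums for all smaller
  \<open>t\<close>.\<close>

lemma has_fps_expansion_infsum_exp:
  fixes c a :: "'i \<Rightarrow> complex" and F :: "complex \<Rightarrow> complex"
  assumes "\<rho> > 0"
    and summable: "(\<lambda>i. norm (c i) * exp (norm (a i) * \<rho>)) summable_on A"
    and F: "\<And>t. norm t < \<rho> \<Longrightarrow> F t = (\<Sum>\<^sub>\<infinity>i\<in>A. c i * exp (a i * t))"
  shows "F has_fps_expansion Abs_fps (\<lambda>n. (\<Sum>\<^sub>\<infinity>i\<in>A. c i * a i ^ n) / fact n)"
proof (rule has_fps_expansionI)
  have "(\<lambda>n. fps_nth (Abs_fps (\<lambda>n. (\<Sum>\<^sub>\<infinity>i\<in>A. c i * a i ^ n) / fact n)) n * t ^ n) sums F t"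
    if t: "norm t < \<rho>" for t
  proof -
    define g where "g = (\<lambda>(i, n). c i * ((a i * t) ^ n / fact n))"
    have exp_norm: "((\<lambda>n. norm (z ^ n / fact n)) has_sum exp (norm z)) UNIV" for z :: complex
    proof (rule norm_summable_imp_has_sum)
      have "(\<lambda>n. norm z ^ n / fact n) sums exp (norm z)"
        using exp_converges[of "norm z"] by (simp add: field_simps scaleR_conv_of_real)
      then show *: "(\<lambda>n. norm (z ^ n / fact n)) sums exp (norm z)"
        by (simp add: norm_divide norm_power)
      show "summable (\<lambda>n. norm (norm (z ^ n / fact n)))"
        using sums_summable[OF *] by simp
    qed
    have exp_sum: "((\<lambda>n. z ^ n / fact n) has_sum exp z) UNIV" for z :: complex
    proof (rule norm_summable_imp_has_sum)
      show "(\<lambda>n. z ^ n / fact n) sums exp z"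
        using exp_converges[of z] by (simp add: field_simps scaleR_conv_of_real)
      show "summable (\<lambda>n. norm (z ^ n / fact n))"
        using exp_norm[of z] has_sum_imp_sums sums_summable by blast
    qed
    have "(\<lambda>p. norm (g p)) summable_on (A \<times> UNIV)"
    proof (rule summable_on_SigmaI)
      show "((\<lambda>n. norm (g (i, n))) has_sum norm (c i) * exp (norm (a i * t))) UNIV" for i
        using has_sum_cmult_right[OF exp_norm[of "a i * t"], of "norm (c i)"]
        by (simp add: g_def norm_mult norm_divide)
      show "(\<lambda>i. norm (c i) * exp (norm (a i * t))) summable_on A"
        by (rule summable_on_comparison_test[OF summable])
          (use t in \<open>auto simp: norm_mult intro!: mult_left_mono\<close>)
    qed auto
    then have gsum: "g summable_on (A \<times> UNIV)"
      by (rule abs_summable_summable)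
    then obtain S where S: "(g has_sum S) (A \<times> UNIV)"
      by (auto simp: summable_on_def)
    have row: "((\<lambda>n. g (i, n)) has_sum c i * exp (a i * t)) UNIV" for i
      using has_sum_cmult_right[OF exp_sum[of "a i * t"], of "c i"] by (simp add: g_def)
    \<comment> \<open>The double sum \<open>S\<close> is evaluated twice: by rows (fixed
      \<open>i\<close>) it is \<open>F t\<close>, by columns (fixed \<open>n\<close>) it is the
      power series.\<close>
    have "((\<lambda>i. c i * exp (a i * t)) has_sum S) A"
      by (rule has_sum_SigmaD[OF S row])
    then have "F t = S"
      using F[OF t] infsumI by metis
    have swap: "((\<lambda>(n, i). g (i, n)) has_sum S) (UNIV \<times> A)"
      using S has_sum_swap by blast
    have column: "((\<lambda>i. g (i, n)) has_sum (\<Sum>\<^sub>\<infinity>i\<in>A. c i * a i ^ n) / fact n * t ^ n) A" for n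
    proof -
      \<comment> \<open>The value of \<open>infsum\<close> alone would not suffice, as it defaults
        to 0 for a divergent family; each column inherits convergence from the double sum.\<close>
      have "(\<lambda>i. g (i, n)) summable_on A"
        by (rule summable_on_SigmaD1[of "\<lambda>n i. g (i, n)" UNIV "\<lambda>_. A"])
          (use swap in \<open>auto simp: summable_on_def\<close>)
      moreover have "(\<Sum>\<^sub>\<infinity>i\<in>A. g (i, n)) = (\<Sum>\<^sub>\<infinity>i\<in>A. c i * a i ^ n) / fact n * t ^ n"
        using infsum_cmult_left'[of "\<lambda>i. c i * a i ^ n" "t ^ n / fact n" A]
        by (simp add: g_def power_mult_distrib mult_ac)
      ultimately show ?thesis
        using has_sum_infsum by metis
    qed
    have "((\<lambda>n. (\<Sum>\<^sub>\<infinity>i\<in>A. c i * a i ^ n) / fact n * t ^ n) has_sum S) UNIV"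
      using has_sum_SigmaD[OF swap, of "\<lambda>n. (\<Sum>\<^sub>\<infinity>i\<in>A. c i * a i ^ n) / fact n * t ^ n"] column
      by simp
    then show ?thesis
      using has_sum_imp_sums \<open>F t = S\<close> by fastforce
  qed
  moreover have "eventually (\<lambda>t. t \<in> ball 0 \<rho>) (nhds (0 :: complex))"
    using \<open>\<rho> > 0\<close> by (intro eventually_nhds_in_open) auto
  ultimately show "eventually (\<lambda>t. (\<lambda>n. fps_nth (Abs_fps (\<lambda>n. (\<Sum>\<^sub>\<infinity>i\<in>A. c i * a i ^ n) / fact n)) n
      * t ^ n) sums F t) (nhds 0)"
    by (auto elim!: eventually_mono)
qed

text \<open>Kept general in the field because it is applied both to a complex ratio and to its real
  norm.\<close>

lemma geometric_has_sum:
  fixes z :: "'a :: {real_normed_field, banach}"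
  assumes "norm z < 1"
  shows "((\<lambda>n. z ^ n) has_sum (1 / (1 - z))) UNIV"
  using assms by (intro norm_summable_imp_has_sum geometric_sums)
    (auto simp: norm_power intro!: summable_geometric)

text \<open>A product of absolutely convergent series converges absolutely over tuples. This serves
  both to factor the sum over tuples and to provide the majorant at \<open>t = \<rho>\<close> in the
  theorem.\<close>

lemma geometric_PiE_abs_summable:
  fixes z :: "'j \<Rightarrow> complex"
  assumes "finite J" "\<And>j. j \<in> J \<Longrightarrow> norm (z j) < 1"
  shows "(\<lambda>m. norm (\<Prod>j\<in>J. z j ^ m j)) summable_on (J \<rightarrow>\<^sub>E (UNIV :: nat set))"
proof -
  have "Infinite_Set_Sum.abs_summable_on (\<lambda>n. z j ^ n) UNIV" if "j \<in> J" for j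
    unfolding abs_summable_equivalent[symmetric]
    using geometric_has_sum[of "norm (z j)"] assms that
    by (auto simp: norm_power summable_on_def)
  then show ?thesis
    unfolding abs_summable_equivalent
    using assms by (intro abs_summable_on_prod_PiE) auto
qed

lemma geometric_PiE_infsum:
  fixes z :: "'j \<Rightarrow> complex"
  assumes "finite J" "\<And>j. j \<in> J \<Longrightarrow> norm (z j) < 1"
  shows "(\<Sum>\<^sub>\<infinity>m\<in>J \<rightarrow>\<^sub>E (UNIV :: nat set). \<Prod>j\<in>J. z j ^ m j) = (\<Prod>j\<in>J. 1 / (1 - z j))"
proof -
  have "(\<Sum>\<^sub>\<infinity>m\<in>J \<rightarrow>\<^sub>E (UNIV :: nat set). \<Prod>j\<in>J. z j ^ m j) = (\<Prod>j\<in>J. \<Sum>\<^sub>\<infinity>n. z j ^ n)"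
  proof (rule infsum_prod_PiE)
    show "(\<lambda>n. z j ^ n) summable_on UNIV" if "j \<in> J" for j
      using geometric_has_sum assms that by (metis summable_on_def)
    show "(\<lambda>m. \<Prod>j\<in>J. z j ^ m j) summable_on (J \<rightarrow>\<^sub>E UNIV)"
      using geometric_PiE_abs_summable[OF assms] by (rule abs_summable_summable)
  qed (fact assms)
  also have "\<dots> = (\<Prod>j\<in>J. 1 / (1 - z j))"
    by (intro prod.cong refl infsumI geometric_has_sum assms)
  finally show ?thesis .
qed

theorem theorem7:
  fixes r n :: nat and w :: "nat \<Rightarrow> real" and q L x :: complex
  assumes "\<And>j. j \<in> {1..r} \<Longrightarrow> w j > 0"
    and "0 < norm q" and "norm q < 1"
    and "exp L = q"
    and "Re x > 0"
  shows "q_zeta L r w (- of_nat n) x = q_euler L r w n x"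
proof -
  define A where "A = {1..r} \<rightarrow>\<^sub>E (UNIV :: nat set)"
  define a :: "(nat \<Rightarrow> nat) \<Rightarrow> complex"
    where "a = (\<lambda>m. x + (\<Sum>j=1..r. of_real (w j) * of_nat (m j)))"
  define c :: "(nat \<Rightarrow> nat) \<Rightarrow> complex"
    where "c = (\<lambda>m. (-1) ^ (\<Sum>j=1..r. m j) * qpow L (\<Sum>j=1..r. real (m j) * w j))"
  \<comment> \<open>With this sign, \<open>1 - z t j\<close> is the \<open>j\<close>-th factor in
    the denominator of the generating function.\<close>
  define z :: "complex \<Rightarrow> nat \<Rightarrow> complex"
    where "z = (\<lambda>t j. - exp (of_real (w j) * (t + L)))"
  \<comment> \<open>Any value strictly between 0 and \<open>- Re L\<close> would do; the interval is
    nonempty because \<open>norm q = exp (Re L) < 1\<close>.\<close>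
  define \<rho> where "\<rho> = - Re L / 2"
  have "Re L < 0"
    using assms(3,4) by (auto simp: norm_exp_eq_Re)
  then have \<rho>: "\<rho> > 0" "Re L + \<rho> < 0"
    by (auto simp: \<rho>_def)
  \<comment> \<open>The norm is \<open>exp (w j * (Re t + Re L))\<close>, so only
    \<open>Re t\<close> matters. The bound is not strict so that the real point
    \<open>t = \<rho>\<close> is included.\<close>
  have z_less_1: "norm (z t j) < 1" if "Re t \<le> \<rho>" "j \<in> {1..r}" for t j
    using that assms(1) \<rho> by (auto simp: z_def norm_exp_eq_Re mult_pos_neg)
  have term_eq: "c m * exp (a m * t) = exp (x * t) * (\<Prod>j=1..r. z t j ^ m j)" for m t
  proof -
    have "(\<Prod>j=1..r. z t j ^ m j)
      = (\<Prod>j=1..r. (-1) ^ m j * exp (of_nat (m j) * (of_real (w j) * (t + L))))"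
      unfolding z_def by (intro prod.cong refl, subst power_minus) (simp add: exp_of_nat_mult)
    also have "\<dots> = (-1) ^ (\<Sum>j=1..r. m j)
        * exp (\<Sum>j=1..r. of_nat (m j) * (of_real (w j) * (t + L)))"
      by (simp add: prod.distrib power_sum exp_sum)
    finally show ?thesis
      by (simp add: c_def a_def qpow_def exp_add [symmetric] sum_distrib_left sum_distrib_right
          algebra_simps sum.distrib flip: mult_exp_exp)
  qed
  \<comment> \<open>The geometric series at \<open>t = \<rho>\<close> controls only
    \<open>norm (c m) * exp (Re (a m) * \<rho>)\<close>. Since \<open>a m - x\<close> is a
    nonnegative real, \<open>norm (a m)\<close> exceeds \<open>Re (a m)\<close> by at most
    \<open>norm x - Re x\<close>, which costs a factor independent of \<open>m\<close>.\<close>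
  have "(\<lambda>m. norm (c m) * exp (norm (a m) * \<rho>)) summable_on A"
  proof (rule summable_on_comparison_test)
    show "(\<lambda>m. exp ((norm x - Re x) * \<rho>) * norm (exp (x * of_real \<rho>) * (\<Prod>j=1..r. z (of_real \<rho>) j ^ m j)))
        summable_on A"
      unfolding A_def norm_mult
      using z_less_1[of "of_real \<rho>"]
      by (intro summable_on_cmult_right geometric_PiE_abs_summable) auto
    fix m
    have "norm (a m) \<le> norm x + norm (\<Sum>j=1..r. complex_of_real (w j) * of_nat (m j))"
      unfolding a_def by (rule norm_triangle_ineq)
    also have "norm (\<Sum>j=1..r. complex_of_real (w j) * of_nat (m j)) \<le> (\<Sum>j=1..r. w j * real (m j))"
      by (rule order.trans[OF norm_sum], rule sum_mono)
        (use assms(1) in \<open>force simp: norm_mult abs_of_pos\<close>)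
    also have "norm x + (\<Sum>j=1..r. w j * real (m j)) = norm x - Re x + Re (a m)"
      by (simp add: a_def)
    finally have "norm (a m) * \<rho> \<le> (norm x - Re x) * \<rho> + Re (a m) * \<rho>"
      using \<rho> by (simp flip: distrib_right)
    then show "norm (c m) * exp (norm (a m) * \<rho>)
      \<le> exp ((norm x - Re x) * \<rho>) * norm (exp (x * of_real \<rho>) * (\<Prod>j=1..r. z (of_real \<rho>) j ^ m j))"
      unfolding term_eq[symmetric]
      by (auto simp: norm_mult norm_exp_eq_Re mult.left_commute intro!: mult_left_mono
          simp flip: exp_add)
  qed auto
  moreover have "q_euler_gf L r w x t = (\<Sum>\<^sub>\<infinity>m\<in>A. 2 ^ r * c m * exp (a m * t))"
    if "norm t < \<rho>" for t
  proof -
    have "Re t \<le> \<rho>"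
      using that complex_Re_le_cmod[of t] by linarith
    then have "(\<Sum>\<^sub>\<infinity>m\<in>A. \<Prod>j=1..r. z t j ^ m j) = (\<Prod>j=1..r. 1 / (1 - z t j))"
      unfolding A_def by (intro geometric_PiE_infsum z_less_1) auto
    moreover have "(\<Prod>j=1..r. 1 / (1 - z t j))
        = 1 / (\<Prod>j=1..r. exp (of_real (w j) * t) * qpow L (w j) + 1)"
      unfolding prod_dividef
      by (simp add: z_def qpow_def exp_add distrib_left add.commute)
    ultimately show ?thesis
      by (simp add: q_euler_gf_def term_eq mult.assoc infsum_cmult_right')
  qed
  ultimately have "q_euler_gf L r w x has_fps_expansion
      Abs_fps (\<lambda>n. (\<Sum>\<^sub>\<infinity>m\<in>A. 2 ^ r * c m * a m ^ n) / fact n)"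
    using \<rho> by (intro has_fps_expansion_infsum_exp[of \<rho>])
      (auto simp: norm_mult mult.assoc intro!: summable_on_cmult_right)
  then have "q_euler L r w n x = (\<Sum>\<^sub>\<infinity>m\<in>A. 2 ^ r * c m * a m ^ n)"
    by (simp add: q_euler_def fps_expansion_eqI)
  moreover have "c m / a m powr (- of_nat n) = c m * a m ^ n" for m
  proof -
    have "(\<Sum>j=1..r. w j * real (m j)) \<ge> 0"
      using assms(1) by (intro sum_nonneg) (simp add: order.strict_implies_order)
    then have "Re (a m) > 0"
      using assms(5) by (simp add: a_def)
    \<comment> \<open>This matters for \<open>n = 0\<close>, where \<open>0 powr 0 = 0\<close> but
      \<open>0 ^ 0 = 1\<close>.\<close>
    then have "a m \<noteq> 0"
      by auto
    then show ?thesis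
      by (simp add: powr_minus powr_nat' divide_inverse)
  qed
  then have "q_zeta L r w (- of_nat n) x = 2 ^ r * (\<Sum>\<^sub>\<infinity>m\<in>A. c m * a m ^ n)"
    unfolding q_zeta_def A_def a_def c_def by (intro arg_cong2[of _ _ _ _ times] infsum_cong refl)
  ultimately show ?thesis
    by (simp add: mult.assoc infsum_cmult_right')
qed

end
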